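(* If $R$ is a commutative reduced ring which is weakly Baer, then $\mathbf{W}(R)=R$.
   Context: All rings are unitary; a ring is reduced if it has no non-zero nilpotent elements. A reduced ring $S$ is weakly Baer if the annihilator of each $s\in S$ is of the form $eS$ for some idempotent $e\in S$. For a commutative reduced ring $R$, let $Q(R)\supseteq R$ be its complete (maximal) ring of quotients; it is a commutative von Neumann regular ring and hence weakly Baer. For $r\in R$ let $e(r)\in Q(R)$ be the idempotent with $\mathrm{ann}_{Q(R)}\, r=e(r)Q(R)$. $\mathbf{W}(R)$ denotes the subring of $Q(R)$ generated by $R$ and all the idempotents $e(r)$, $r\in R$. *)

theory Defs
  imports "HOL-Algebra.QuotRing" "HOL-Algebra.Generated_Rings"
begin

definition reduced_ring :: "('a, 'b) ring_scheme \<Rightarrow> bool" where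
  "reduced_ring S \<longleftrightarrow> ring S \<and>
     (\<forall>x\<in>carrier S. \<forall>n::nat. x [^]\<^bsub>S\<^esub> n = \<zero>\<^bsub>S\<^esub> \<longrightarrow> x = \<zero>\<^bsub>S\<^esub>)"

definition is_idempotent :: "('a, 'b) ring_scheme \<Rightarrow> 'a \<Rightarrow> bool" where
  "is_idempotent S e \<longleftrightarrow> e \<in> carrier S \<and> e \<otimes>\<^bsub>S\<^esub> e = e"

text \<open>Right annihilator; in a reduced ring it coincides with the left annihilator.\<close>

definition annihilator :: "('a, 'b) ring_scheme \<Rightarrow> 'a \<Rightarrow> 'a set" where
  "annihilator S s = {x \<in> carrier S. s \<otimes>\<^bsub>S\<^esub> x = \<zero>\<^bsub>S\<^esub>}"

definition weakly_Baer :: "('a, 'b) ring_scheme \<Rightarrow> bool" where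
  "weakly_Baer S \<longleftrightarrow> reduced_ring S \<and>
     (\<forall>s\<in>carrier S. \<exists>e. is_idempotent S e \<and>
        annihilator S s = (\<lambda>x. e \<otimes>\<^bsub>S\<^esub> x) ` carrier S)"


section \<open>The complete ring of quotients of a commutative ring\<close>

text \<open>
  This is Lambek's construction.  An ideal \<open>D\<close> of \<open>R\<close> is dense if its annihilator is zero; a
  fraction is an \<open>R\<close>-module homomorphism \<open>f : D \<rightarrow> R\<close> defined on a dense ideal, encoded as the pair
  \<open>(D, f)\<close> with \<open>f\<close> extensional.  Fractions are identified when they agree on the
  intersection of their domains; sums are taken on the intersection of the domains, and the
  product of \<open>f\<close> and \<open>g\<close> is the composition \<open>f \<circ> g\<close> on the preimage under \<open>g\<close> of the domain of \<open>f\<close>.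
\<close>

definition dense_ideal :: "('a, 'b) ring_scheme \<Rightarrow> 'a set \<Rightarrow> bool" where
  "dense_ideal R D \<longleftrightarrow> ideal D R \<and>
     (\<forall>r\<in>carrier R. (\<forall>d\<in>D. r \<otimes>\<^bsub>R\<^esub> d = \<zero>\<^bsub>R\<^esub>) \<longrightarrow> r = \<zero>\<^bsub>R\<^esub>)"

type_synonym 'a fraction = "'a set \<times> ('a \<Rightarrow> 'a)"

definition fractions :: "('a, 'b) ring_scheme \<Rightarrow> 'a fraction set" where
  "fractions R = {(D, f). dense_ideal R D \<and> f \<in> D \<rightarrow>\<^sub>E carrier R \<and>
     (\<forall>x\<in>D. \<forall>y\<in>D. f (x \<oplus>\<^bsub>R\<^esub> y) = f x \<oplus>\<^bsub>R\<^esub> f y) \<and>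
     (\<forall>r\<in>carrier R. \<forall>x\<in>D. f (r \<otimes>\<^bsub>R\<^esub> x) = r \<otimes>\<^bsub>R\<^esub> f x)}"

definition frac_rel :: "('a, 'b) ring_scheme \<Rightarrow> ('a fraction \<times> 'a fraction) set" where
  "frac_rel R = {(F, G). F \<in> fractions R \<and> G \<in> fractions R \<and>
     (\<forall>x \<in> fst F \<inter> fst G. snd F x = snd G x)}"

definition frac_class :: "('a, 'b) ring_scheme \<Rightarrow> 'a fraction \<Rightarrow> 'a fraction set" where
  "frac_class R F = frac_rel R `` {F}"

definition frac_add :: "('a, 'b) ring_scheme \<Rightarrow> 'a fraction \<Rightarrow> 'a fraction \<Rightarrow> 'a fraction" where
  "frac_add R F G =
     (fst F \<inter> fst G, restrict (\<lambda>x. snd F x \<oplus>\<^bsub>R\<^esub> snd G x) (fst F \<inter> fst G))"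

definition frac_mult :: "'a fraction \<Rightarrow> 'a fraction \<Rightarrow> 'a fraction" where
  "frac_mult F G =
     (let E = {x \<in> fst G. snd G x \<in> fst F} in (E, restrict (\<lambda>x. snd F (snd G x)) E))"

text \<open>The element \<open>r\<close> of \<open>R\<close> as a fraction: multiplication by \<open>r\<close> on all of \<open>R\<close>.\<close>

definition frac_of :: "('a, 'b) ring_scheme \<Rightarrow> 'a \<Rightarrow> 'a fraction" where
  "frac_of R r = (carrier R, restrict (\<lambda>x. r \<otimes>\<^bsub>R\<^esub> x) (carrier R))"

definition quot_emb :: "('a, 'b) ring_scheme \<Rightarrow> 'a \<Rightarrow> 'a fraction set" where
  "quot_emb R r = frac_class R (frac_of R r)"

definition Quot_ring :: "('a, 'b) ring_scheme \<Rightarrow> ('a fraction set) ring" where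
  "Quot_ring R =
     \<lparr>carrier = fractions R // frac_rel R,
      mult = (\<lambda>A B. \<Union>F\<in>A. \<Union>G\<in>B. frac_class R (frac_mult F G)),
      one = quot_emb R \<one>\<^bsub>R\<^esub>,
      zero = quot_emb R \<zero>\<^bsub>R\<^esub>,
      add = (\<lambda>A B. \<Union>F\<in>A. \<Union>G\<in>B. frac_class R (frac_add R F G))\<rparr>"


section \<open>The ring W(R)\<close>

text \<open>
  \<open>ann_idem R r\<close> is the idempotent \<open>e(r)\<close> of the complete ring of quotients \<open>Q\<close> with
  \<open>ann\<^sub>Q(r) = e(r)Q\<close>.
\<close>

definition ann_idem :: "('a, 'b) ring_scheme \<Rightarrow> 'a \<Rightarrow> 'a fraction set" where
  "ann_idem R r = (THE e. is_idempotent (Quot_ring R) e \<and>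
     annihilator (Quot_ring R) (quot_emb R r) =
       (\<lambda>x. e \<otimes>\<^bsub>Quot_ring R\<^esub> x) ` carrier (Quot_ring R))"

definition W_ring :: "('a, 'b) ring_scheme \<Rightarrow> 'a fraction set set" where
  "W_ring R = generate_ring (Quot_ring R)
     (quot_emb R ` carrier R \<union> ann_idem R ` carrier R)"


section \<open>Well-definedness\<close>

text \<open>
  \<open>Quot_ring R\<close> is a commutative ring containing \<open>R\<close> via \<open>quot_emb R\<close>, and for reduced \<open>R\<close> the
  description defining \<open>ann_idem R r\<close> has exactly one solution.
\<close>

context cring
begin

definition dense_set where "dense_set E \<longleftrightarrow> E \<subseteq> carrier R \<and>
  (\<forall>r\<in>carrier R. (\<forall>d\<in>E. r \<otimes> d = \<zero>) \<longrightarrow> r = \<zero>)"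

definition set_prods where "set_prods D D' = {x \<otimes> y | x y. x \<in> D \<and> y \<in> D'}"

lemma dense_idealD:
  assumes "dense_ideal R D"
  shows "ideal D R" "D \<subseteq> carrier R" "dense_set D" "\<zero> \<in> D"
    "\<And>x y. x \<in> D \<Longrightarrow> y \<in> D \<Longrightarrow> x \<oplus> y \<in> D"
    "\<And>r x. r \<in> carrier R \<Longrightarrow> x \<in> D \<Longrightarrow> r \<otimes> x \<in> D"
    "\<And>r x. r \<in> carrier R \<Longrightarrow> x \<in> D \<Longrightarrow> x \<otimes> r \<in> D"
proof -
  show i: "ideal D R" using assms by (simp add: dense_ideal_def)
  interpret ideal D R by (rule i)
  show "D \<subseteq> carrier R" by (rule a_subset)
  then show "dense_set D" using assms by (auto simp: dense_ideal_def dense_set_def)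
  show "\<zero> \<in> D" by simp
  show "\<And>x y. x \<in> D \<Longrightarrow> y \<in> D \<Longrightarrow> x \<oplus> y \<in> D" by simp
  show "\<And>r x. r \<in> carrier R \<Longrightarrow> x \<in> D \<Longrightarrow> r \<otimes> x \<in> D" by (rule I_l_closed)
  show "\<And>r x. r \<in> carrier R \<Longrightarrow> x \<in> D \<Longrightarrow> x \<otimes> r \<in> D" by (rule I_r_closed)
qed

lemma dense_set_prods:
  assumes "dense_set D" "dense_set E" shows "dense_set (set_prods D E)"
  unfolding dense_set_def
proof (intro conjI ballI impI)
  show "set_prods D E \<subseteq> carrier R" using assms by (auto simp: dense_set_def set_prods_def)
  fix r assume r: "r \<in> carrier R" and z: "\<forall>d\<in>set_prods D E. r \<otimes> d = \<zero>"
  have "r \<otimes> x = \<zero>" if x: "x \<in> D" for x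
  proof -
    have xc: "x \<in> carrier R" using x assms by (auto simp: dense_set_def)
    have "(r \<otimes> x) \<otimes> y = \<zero>" if "y \<in> E" for y
    proof -
      have "y \<in> carrier R" using that assms by (auto simp: dense_set_def)
      then show ?thesis using z x that r xc by (auto simp: set_prods_def m_assoc)
    qed
    then show ?thesis using assms(2) r xc by (auto simp: dense_set_def)
  qed
  then show "r = \<zero>" using assms(1) r by (auto simp: dense_set_def)
qed

lemma dense_idealI:
  assumes "D \<subseteq> carrier R" "\<zero> \<in> D"
    "\<And>x y. x \<in> D \<Longrightarrow> y \<in> D \<Longrightarrow> x \<oplus> y \<in> D"
    "\<And>r x. r \<in> carrier R \<Longrightarrow> x \<in> D \<Longrightarrow> r \<otimes> x \<in> D"
    "dense_set E" "E \<subseteq> D"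
  shows "dense_ideal R D"
proof -
  have inv: "\<ominus> x \<in> D" if "x \<in> D" for x
  proof -
    have "\<ominus> x = (\<ominus> \<one>) \<otimes> x" using that assms(1) by (auto simp: l_minus)
    then show ?thesis using assms(4)[of "\<ominus> \<one>" x] that by simp
  qed
  have "ideal D R"
  proof (rule idealI)
    show "ring R" by (rule ring_axioms)
    show "subgroup D (add_monoid R)"
      by (rule subgroup.intro) (use assms inv in \<open>auto simp: a_inv_def\<close>)
    fix a x assume ax: "a \<in> D" "x \<in> carrier R"
    show "x \<otimes> a \<in> D" using ax assms by blast
    then show "a \<otimes> x \<in> D" using ax assms(1) m_comm by (metis subsetD)
  qed
  moreover have "r = \<zero>" if "r \<in> carrier R" "\<forall>d\<in>D. r \<otimes> d = \<zero>" for r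
    using assms(5,6) that unfolding dense_set_def by blast
  ultimately show ?thesis unfolding dense_ideal_def by blast
qed

lemma fractionsD:
  assumes "F \<in> fractions R"
  shows "dense_ideal R (fst F)" "snd F \<in> extensional (fst F)"
    "\<And>x. x \<in> fst F \<Longrightarrow> snd F x \<in> carrier R"
    "\<And>x y. x \<in> fst F \<Longrightarrow> y \<in> fst F \<Longrightarrow> snd F (x \<oplus> y) = snd F x \<oplus> snd F y"
    "\<And>r x. r \<in> carrier R \<Longrightarrow> x \<in> fst F \<Longrightarrow> snd F (r \<otimes> x) = r \<otimes> snd F x"
  using assms by (auto simp: fractions_def PiE_def split: prod.splits)

lemma fractions_carr: "F \<in> fractions R \<Longrightarrow> x \<in> fst F \<Longrightarrow> x \<in> carrier R"
  using dense_idealD(2) fractionsD(1) by blast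

lemma fractions_pair:
  assumes "(D, f) \<in> fractions R" "x \<in> D" shows "x \<in> carrier R" "f x \<in> carrier R"
  using fractions_carr[OF assms(1)] fractionsD(3)[OF assms(1)] assms(2) by auto

lemma fractionsI:
  assumes "dense_ideal R D"
    "\<And>x. x \<in> D \<Longrightarrow> f x \<in> carrier R"
    "\<And>x y. x \<in> D \<Longrightarrow> y \<in> D \<Longrightarrow> f (x \<oplus> y) = f x \<oplus> f y"
    "\<And>r x. r \<in> carrier R \<Longrightarrow> x \<in> D \<Longrightarrow> f (r \<otimes> x) = r \<otimes> f x"
  shows "(D, restrict f D) \<in> fractions R"
  using assms dense_idealD(5,6)[OF assms(1)] by (auto simp: fractions_def)

lemma dense_Int:
  assumes D: "dense_ideal R D" and E: "dense_ideal R E"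
  shows "dense_ideal R (D \<inter> E)"
proof (rule dense_idealI)
  note d = dense_idealD[OF D] and e = dense_idealD[OF E]
  show "D \<inter> E \<subseteq> carrier R" "\<zero> \<in> D \<inter> E" using d(2,4) e(4) by blast+
  show "x \<oplus> y \<in> D \<inter> E" if "x \<in> D \<inter> E" "y \<in> D \<inter> E" for x y using that d(5) e(5) by blast
  show "r \<otimes> x \<in> D \<inter> E" if "r \<in> carrier R" "x \<in> D \<inter> E" for r x using that d(6) e(6) by blast
  show "dense_set (set_prods D E)" using d(3) e(3) by (rule dense_set_prods)
  show "set_prods D E \<subseteq> D \<inter> E" using d(2,7) e(2,6) unfolding set_prods_def by blast
qed

lemma snd_zero: "F \<in> fractions R \<Longrightarrow> snd F \<zero> = \<zero>"
  using fractionsD(3)[of F \<zero>] fractionsD(5)[of F \<zero> \<zero>] dense_idealD(4)[OF fractionsD(1)[of F]] by simp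

lemma prods_frac:
  assumes "F \<in> fractions R" "G \<in> fractions R" "x \<in> fst F" "y \<in> fst G"
  shows "x \<otimes> y \<in> fst F" "x \<otimes> y \<in> fst G"
    "snd F (x \<otimes> y) = snd F x \<otimes> y" "snd G (x \<otimes> y) = x \<otimes> snd G y"
    "snd F (x \<otimes> y) \<in> fst G" "snd G (x \<otimes> y) \<in> fst F"
proof -
  note c = fractions_carr[OF assms(1,3)] fractions_carr[OF assms(2,4)]
    fractionsD(3)[OF assms(1,3)] fractionsD(3)[OF assms(2,4)]
  note d = dense_idealD[OF fractionsD(1)[OF assms(1)]] dense_idealD[OF fractionsD(1)[OF assms(2)]]
  show "x \<otimes> y \<in> fst F" "x \<otimes> y \<in> fst G" using c d assms by auto
  show 1: "snd F (x \<otimes> y) = snd F x \<otimes> y"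
    using fractionsD(5)[OF assms(1), of y x] c assms by (simp add: m_comm)
  show 2: "snd G (x \<otimes> y) = x \<otimes> snd G y"
    using fractionsD(5)[OF assms(2)] c assms by simp
  show "snd F (x \<otimes> y) \<in> fst G" "snd G (x \<otimes> y) \<in> fst F"
    unfolding 1 2 using c d assms by auto
qed

lemma frac_add_closed:
  assumes "F \<in> fractions R" "G \<in> fractions R"
  shows "frac_add R F G \<in> fractions R"
  unfolding frac_add_def
proof (rule fractionsI)
  show "dense_ideal R (fst F \<inter> fst G)" using assms by (intro dense_Int fractionsD)
  fix x y assume xy: "x \<in> fst F \<inter> fst G" "y \<in> fst F \<inter> fst G"
  then have c: "snd F x \<in> carrier R" "snd G x \<in> carrier R" "snd F y \<in> carrier R" "snd G y \<in> carrier R"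
    using fractionsD(3)[OF assms(1)] fractionsD(3)[OF assms(2)] by blast+
  show "snd F x \<oplus> snd G x \<in> carrier R" using c by simp
  have "snd F (x \<oplus> y) = snd F x \<oplus> snd F y" "snd G (x \<oplus> y) = snd G x \<oplus> snd G y"
    using fractionsD(4)[OF assms(1)] fractionsD(4)[OF assms(2)] xy by blast+
  then show "snd F (x \<oplus> y) \<oplus> snd G (x \<oplus> y) = snd F x \<oplus> snd G x \<oplus> (snd F y \<oplus> snd G y)"
    using c by (simp add: a_ac)
next
  fix r x assume r: "r \<in> carrier R" and x: "x \<in> fst F \<inter> fst G"
  have "snd F (r \<otimes> x) = r \<otimes> snd F x" "snd G (r \<otimes> x) = r \<otimes> snd G x"
    using fractionsD(5)[OF assms(1)] fractionsD(5)[OF assms(2)] r x by blast+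
  moreover have "snd F x \<in> carrier R" "snd G x \<in> carrier R"
    using fractionsD(3)[OF assms(1)] fractionsD(3)[OF assms(2)] x by blast+
  ultimately show "snd F (r \<otimes> x) \<oplus> snd G (r \<otimes> x) = r \<otimes> (snd F x \<oplus> snd G x)"
    using r by (simp add: r_distr)
qed

lemma frac_mult_closed:
  assumes F: "F \<in> fractions R" and G: "G \<in> fractions R"
  shows "frac_mult F G \<in> fractions R"
  unfolding frac_mult_def Let_def
proof (rule fractionsI)
  note d = dense_idealD[OF fractionsD(1)[OF F]] and e = dense_idealD[OF fractionsD(1)[OF G]]
  note f = fractionsD(3-5)[OF F] and g = fractionsD(3-5)[OF G]
  let ?E = "{x \<in> fst G. snd G x \<in> fst F}"
  show "dense_ideal R ?E"
  proof (rule dense_idealI)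
    show "?E \<subseteq> carrier R" using e(2) by blast
    show "\<zero> \<in> ?E" using snd_zero[OF G] d(4) e(4) by simp
    show "x \<oplus> y \<in> ?E" if "x \<in> ?E" "y \<in> ?E" for x y using that d(5) e(5) g(2) by simp
    show "r \<otimes> x \<in> ?E" if "r \<in> carrier R" "x \<in> ?E" for r x using that d(6) e(6) g(3) by simp
    show "dense_set (set_prods (fst F) (fst G))" using d(3) e(3) by (rule dense_set_prods)
    show "set_prods (fst F) (fst G) \<subseteq> ?E"
      using prods_frac(2,6)[OF F G] unfolding set_prods_def by blast
  qed
  show "snd F (snd G x) \<in> carrier R" if "x \<in> ?E" for x using that f(1) by blast
  show "snd F (snd G (x \<oplus> y)) = snd F (snd G x) \<oplus> snd F (snd G y)" if "x \<in> ?E" "y \<in> ?E" for x y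
    using that f(2) g(2) by simp
  show "snd F (snd G (r \<otimes> x)) = r \<otimes> snd F (snd G x)" if "r \<in> carrier R" "x \<in> ?E" for r x
    using that f(3) g(3) by simp
qed

lemma frac_relI:
  assumes "F \<in> fractions R" "G \<in> fractions R" "dense_set E"
    and e: "\<And>x. x \<in> E \<Longrightarrow> x \<in> fst F \<and> x \<in> fst G \<and> snd F x = snd G x"
  shows "(F, G) \<in> frac_rel R"
proof -
  have "snd F x = snd G x" if x: "x \<in> fst F" "x \<in> fst G" for x
  proof -
    note c = fractions_carr[OF assms(1) x(1)] fractionsD(3)[OF assms(1) x(1)] fractionsD(3)[OF assms(2) x(2)]
    have "(snd F x \<ominus> snd G x) \<otimes> y = \<zero>" if y: "y \<in> E" for y
    proof -
      have yc: "y \<in> carrier R" using y assms(3) by (auto simp: dense_set_def)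
      have "snd F (x \<otimes> y) = snd F x \<otimes> y" using prods_frac(3)[OF assms(1) assms(1)] x e[OF y] by blast
      moreover have "snd G (x \<otimes> y) = snd G x \<otimes> y" using prods_frac(3)[OF assms(2) assms(2)] x e[OF y] by blast
      moreover have "snd F (x \<otimes> y) = x \<otimes> snd F y" using prods_frac(4)[OF assms(1) assms(1)] x e[OF y] by blast
      moreover have "snd G (x \<otimes> y) = x \<otimes> snd G y" using prods_frac(4)[OF assms(2) assms(2)] x e[OF y] by blast
      ultimately have "snd F x \<otimes> y = snd G x \<otimes> y" using e[OF y] by simp
      then show ?thesis using c yc by (simp add: minus_eq l_distr l_minus r_neg)
    qed
    then have "snd F x \<ominus> snd G x = \<zero>" using assms(3) c by (auto simp: dense_set_def)
    then show ?thesis using c by simp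
  qed
  then show ?thesis using assms by (auto simp: frac_rel_def)
qed

lemma equiv_frac: "equiv (fractions R) (frac_rel R)"
proof (rule equivI)
  show "frac_rel R \<subseteq> fractions R \<times> fractions R" "refl_on (fractions R) (frac_rel R)" "sym (frac_rel R)"
    by (auto simp: frac_rel_def refl_on_def sym_def)
  show "trans (frac_rel R)"
  proof (rule transI)
    fix F G H assume a: "(F, G) \<in> frac_rel R" "(G, H) \<in> frac_rel R"
    then have f: "F \<in> fractions R" "G \<in> fractions R" "H \<in> fractions R" by (auto simp: frac_rel_def)
    show "(F, H) \<in> frac_rel R"
    proof (rule frac_relI)
      show "dense_set (fst F \<inter> fst G \<inter> fst H)" using f by (intro dense_idealD(3) dense_Int fractionsD)
    qed (use a f in \<open>auto simp: frac_rel_def\<close>)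
  qed
qed

lemma frac_class_eq:
  "F \<in> fractions R \<Longrightarrow> G \<in> fractions R \<Longrightarrow> frac_class R F = frac_class R G \<longleftrightarrow> (F, G) \<in> frac_rel R"
  unfolding frac_class_def using equiv_frac eq_equiv_class_iff by metis

lemma class_eqI:
  "F \<in> fractions R \<Longrightarrow> G \<in> fractions R \<Longrightarrow> (\<And>x. x \<in> fst F \<Longrightarrow> x \<in> fst G \<Longrightarrow> snd F x = snd G x)
   \<Longrightarrow> frac_class R F = frac_class R G"
  by (simp add: frac_class_eq frac_rel_def)

lemma Q_carrier: "carrier (Quot_ring R) = frac_class R ` fractions R"
  by (auto simp: Quot_ring_def quotient_def frac_class_def)

lemma Q_add:
  assumes "F \<in> fractions R" "G \<in> fractions R"
  shows "frac_class R F \<oplus>\<^bsub>Quot_ring R\<^esub> frac_class R G = frac_class R (frac_add R F G)"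
proof -
  have "congruent2 (frac_rel R) (frac_rel R) (\<lambda>F G. frac_class R (frac_add R F G))"
  proof (rule congruent2I')
    fix F F' G G' assume a: "(F, F') \<in> frac_rel R" "(G, G') \<in> frac_rel R"
    then have f: "F \<in> fractions R" "G \<in> fractions R" "F' \<in> fractions R" "G' \<in> fractions R"
      by (auto simp: frac_rel_def)
    have "(frac_add R F G, frac_add R F' G') \<in> frac_rel R"
      using a frac_add_closed f by (auto simp: frac_rel_def frac_add_def)
    then show "frac_class R (frac_add R F G) = frac_class R (frac_add R F' G')"
      using f by (subst frac_class_eq) (auto intro: frac_add_closed)
  qed
  from UN_equiv_class2[OF equiv_frac equiv_frac this assms]
  show ?thesis by (simp add: Quot_ring_def frac_class_def[symmetric])
qed

lemma Q_mult:
  assumes "F \<in> fractions R" "G \<in> fractions R"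
  shows "frac_class R F \<otimes>\<^bsub>Quot_ring R\<^esub> frac_class R G = frac_class R (frac_mult F G)"
proof -
  have "congruent2 (frac_rel R) (frac_rel R) (\<lambda>F G. frac_class R (frac_mult F G))"
  proof (rule congruent2I')
    fix F F' G G' assume a: "(F, F') \<in> frac_rel R" "(G, G') \<in> frac_rel R"
    then have f: "F \<in> fractions R" "G \<in> fractions R" "F' \<in> fractions R" "G' \<in> fractions R"
      by (auto simp: frac_rel_def)
    have "(frac_mult F G, frac_mult F' G') \<in> frac_rel R"
      using a frac_mult_closed f by (auto simp: frac_rel_def frac_mult_def Let_def)
    then show "frac_class R (frac_mult F G) = frac_class R (frac_mult F' G')"
      using f by (subst frac_class_eq) (auto intro: frac_mult_closed)
  qed
  from UN_equiv_class2[OF equiv_frac equiv_frac this assms]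
  show ?thesis by (simp add: Quot_ring_def frac_class_def[symmetric])
qed

lemma dense_set_carrier: "dense_set (carrier R)"
  unfolding dense_set_def using r_one one_closed by (metis subset_refl)

lemma frac_of_closed: "r \<in> carrier R \<Longrightarrow> frac_of R r \<in> fractions R"
  unfolding frac_of_def
  by (rule fractionsI, rule dense_idealI[OF _ _ _ _ dense_set_carrier])
     (auto simp: r_distr m_lcomm)

lemma Q_one: "\<one>\<^bsub>Quot_ring R\<^esub> = frac_class R (frac_of R \<one>)"
  and Q_zero: "\<zero>\<^bsub>Quot_ring R\<^esub> = frac_class R (frac_of R \<zero>)"
  by (simp_all add: Quot_ring_def quot_emb_def)

lemma dense_set_prods_frac: "F \<in> fractions R \<Longrightarrow> G \<in> fractions R \<Longrightarrow> dense_set (set_prods (fst F) (fst G))"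
  by (intro dense_set_prods dense_idealD fractionsD)

theorem Quot_ring_cring: "cring (Quot_ring R)"
proof (rule cringI)
  show "abelian_group (Quot_ring R)"
  proof (rule abelian_groupI, goal_cases)
    case (1 x y)
    then show ?case by (auto simp: Q_carrier Q_add frac_add_closed)
  next
    case 2
    show ?case by (auto simp: Q_carrier Q_zero frac_of_closed)
  next
    case (3 x y z)
    then show ?case
      apply (clarsimp simp: Q_carrier Q_add frac_add_closed)
      apply (rule class_eqI)
      apply (auto intro!: frac_add_closed frac_mult_closed frac_of_closed)
      apply (auto simp: frac_add_def fractions_pair fractionsD a_assoc)
      done
  next
    case (4 x y)
    then show ?case
      apply (clarsimp simp: Q_carrier Q_add frac_add_closed)
      apply (rule class_eqI)
      apply (auto intro!: frac_add_closed frac_mult_closed frac_of_closed)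
      apply (auto simp: frac_add_def fractions_pair fractionsD a_comm)
      done
  next
    case (5 x)
    then show ?case
      apply (clarsimp simp: Q_carrier Q_add Q_zero frac_add_closed frac_of_closed)
      apply (rule class_eqI)
      apply (auto intro!: frac_add_closed frac_mult_closed frac_of_closed)
      apply (auto simp: frac_add_def frac_of_def fractions_pair fractionsD fractions_carr)
      done
  next
    case (6 x)
    then obtain F where F: "F \<in> fractions R" "x = frac_class R F" by (auto simp: Q_carrier)
    let ?G = "(fst F, restrict (\<lambda>x. \<ominus> snd F x) (fst F))"
    have G: "?G \<in> fractions R"
      by (rule fractionsI) (use F in \<open>auto simp: fractionsD minus_add r_minus\<close>)
    have "frac_class R ?G \<oplus>\<^bsub>Quot_ring R\<^esub> x = \<zero>\<^bsub>Quot_ring R\<^esub>"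
      using F G apply (clarsimp simp: Q_carrier Q_add Q_zero frac_add_closed frac_of_closed)
      apply (rule class_eqI)
      apply (auto intro!: frac_add_closed frac_mult_closed frac_of_closed)
      apply (auto simp: frac_add_def frac_of_def fractions_pair fractionsD fractions_carr l_neg)
      done
    then show ?case using G by (auto simp: Q_carrier)
  qed
  show "comm_monoid (Quot_ring R)"
  proof (rule comm_monoidI, goal_cases)
    case (1 x y)
    then show ?case by (auto simp: Q_carrier Q_mult frac_mult_closed)
  next
    case 2
    show ?case by (auto simp: Q_carrier Q_one frac_of_closed)
  next
    case (3 x y z)
    then show ?case
      apply (clarsimp simp: Q_carrier Q_mult frac_mult_closed)
      apply (rule class_eqI)
      apply (auto intro!: frac_add_closed frac_mult_closed frac_of_closed)
      apply (auto simp: frac_mult_def Let_def)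
      done
  next
    case (4 x)
    then show ?case
      apply (clarsimp simp: Q_carrier Q_mult Q_one frac_mult_closed frac_of_closed)
      apply (rule class_eqI)
      apply (auto intro!: frac_add_closed frac_mult_closed frac_of_closed)
      apply (auto simp: frac_mult_def Let_def frac_of_def fractions_pair fractionsD fractions_carr)
      done
  next
    case (5 x y)
    then obtain F G where F: "F \<in> fractions R" "x = frac_class R F"
      and G: "G \<in> fractions R" "y = frac_class R G" by (auto simp: Q_carrier)
    have "(frac_mult F G, frac_mult G F) \<in> frac_rel R"
    proof (rule frac_relI)
      show "dense_set (set_prods (fst F) (fst G))" using F G dense_set_prods_frac by blast
      fix u assume "u \<in> set_prods (fst F) (fst G)"
      then obtain a b where u: "u = a \<otimes> b" and ab: "a \<in> fst F" "b \<in> fst G" by (auto simp: set_prods_def)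
      note p = prods_frac[OF F(1) G(1) ab]
      have "snd F (a \<otimes> snd G b) = snd G (snd F a \<otimes> b)"
      proof -
        have "snd F (snd G b \<otimes> a) = snd G b \<otimes> snd F a"
          using F G ab by (simp add: fractionsD)
        moreover have "snd G (snd F a \<otimes> b) = snd F a \<otimes> snd G b"
          using F G ab by (simp add: fractionsD)
        ultimately show ?thesis using F G ab by (simp add: fractionsD m_comm fractions_carr)
      qed
      then show "u \<in> fst (frac_mult F G) \<and> u \<in> fst (frac_mult G F) \<and> snd (frac_mult F G) u = snd (frac_mult G F) u"
        using p unfolding u by (simp add: frac_mult_def Let_def)
    qed (use F G frac_mult_closed in auto)
    then show ?case using F G by (simp add: Q_mult frac_class_eq frac_mult_closed)
  qed
  fix x y z assume "x \<in> carrier (Quot_ring R)" "y \<in> carrier (Quot_ring R)" "z \<in> carrier (Quot_ring R)"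
  then show "(x \<oplus>\<^bsub>Quot_ring R\<^esub> y) \<otimes>\<^bsub>Quot_ring R\<^esub> z =
    x \<otimes>\<^bsub>Quot_ring R\<^esub> z \<oplus>\<^bsub>Quot_ring R\<^esub> y \<otimes>\<^bsub>Quot_ring R\<^esub> z"
      apply (clarsimp simp: Q_carrier Q_mult Q_add frac_mult_closed frac_add_closed)
      apply (rule class_eqI)
      apply (auto intro!: frac_add_closed frac_mult_closed frac_of_closed)
      apply (auto simp: frac_mult_def Let_def frac_add_def)
      done
qed

theorem quot_emb_hom: "quot_emb R \<in> ring_hom R (Quot_ring R)"
proof (rule ring_hom_memI)
  fix x y assume xy: "x \<in> carrier R" "y \<in> carrier R"
  show "quot_emb R x \<in> carrier (Quot_ring R)" using xy by (auto simp: quot_emb_def Q_carrier frac_of_closed)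
  show "quot_emb R (x \<otimes> y) = quot_emb R x \<otimes>\<^bsub>Quot_ring R\<^esub> quot_emb R y"
    unfolding quot_emb_def Q_mult[OF frac_of_closed frac_of_closed, OF xy]
    by (rule class_eqI)
       (use xy in \<open>simp_all add: frac_of_closed frac_mult_closed\<close>,
        simp add: frac_mult_def Let_def frac_of_def m_assoc)
  show "quot_emb R (x \<oplus> y) = quot_emb R x \<oplus>\<^bsub>Quot_ring R\<^esub> quot_emb R y"
    unfolding quot_emb_def Q_add[OF frac_of_closed frac_of_closed, OF xy]
    by (rule class_eqI)
       (use xy in \<open>simp_all add: frac_of_closed frac_add_closed\<close>,
        simp add: frac_add_def frac_of_def l_distr)
qed (simp add: Quot_ring_def)

theorem quot_emb_inj: "inj_on (quot_emb R) (carrier R)"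
proof (rule inj_onI)
  fix x y assume xy: "x \<in> carrier R" "y \<in> carrier R" and "quot_emb R x = quot_emb R y"
  then have "(frac_of R x, frac_of R y) \<in> frac_rel R" by (simp add: quot_emb_def frac_class_eq frac_of_closed)
  then have "x \<otimes> \<one> = y \<otimes> \<one>" by (auto simp: frac_rel_def frac_of_def)
  then show "x = y" using xy by simp
qed

lemma Q_eq_zero:
  assumes F: "F \<in> fractions R"
  shows "frac_class R F = \<zero>\<^bsub>Quot_ring R\<^esub> \<longleftrightarrow> (\<forall>x\<in>fst F. snd F x = \<zero>)"
proof -
  have "frac_class R F = \<zero>\<^bsub>Quot_ring R\<^esub> \<longleftrightarrow> (F, frac_of R \<zero>) \<in> frac_rel R"
    using F by (simp add: Q_zero frac_class_eq frac_of_closed)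
  also have "\<dots> \<longleftrightarrow> (\<forall>x\<in>fst F. snd F x = \<zero>)"
    using F fractions_carr[OF F] frac_of_closed[of \<zero>]
    by (auto simp: frac_rel_def frac_of_def)
  finally show ?thesis .
qed

theorem ann_idem_ex1:
  assumes red: "reduced_ring R" and r: "r \<in> carrier R"
  shows "\<exists>!e. is_idempotent (Quot_ring R) e \<and>
     annihilator (Quot_ring R) (quot_emb R r) =
       (\<lambda>x. e \<otimes>\<^bsub>Quot_ring R\<^esub> x) ` carrier (Quot_ring R)"
proof -
  interpret Q: cring "Quot_ring R" by (rule Quot_ring_cring)
  let ?A = "annihilator R r"
  have sq: "x = \<zero>" if "x \<in> carrier R" "x \<otimes> x = \<zero>" for x
  proof -
    have "x [^] (2::nat) = \<zero>" using that by (simp add: numeral_2_eq_2)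
    then show ?thesis using red that by (auto simp: reduced_ring_def)
  qed
  let ?P = "\<lambda>d a. a \<in> ?A \<and> (\<exists>x\<in>carrier R. d = r \<otimes> x \<oplus> a)"
  have Ac: "a \<in> carrier R" "r \<otimes> a = \<zero>" if "a \<in> ?A" for a using that by (auto simp: annihilator_def)
  have Aadd: "a \<oplus> b \<in> ?A" if "a \<in> ?A" "b \<in> ?A" for a b
    using that r by (auto simp: annihilator_def r_distr)
  have Amul: "s \<otimes> b \<in> ?A" if "s \<in> carrier R" "b \<in> ?A" for s b
    using that r m_lcomm[of r s b] by (auto simp: annihilator_def)
  have Ainv: "\<ominus> b \<in> ?A" if "b \<in> ?A" for b
    using that r by (auto simp: annihilator_def r_minus)
  have triv: "a = \<zero>" if "a \<in> ?A" "x \<in> carrier R" "a = r \<otimes> x" for a x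
  proof (rule sq)
    show "a \<in> carrier R" using that Ac by auto
    have "a \<otimes> (r \<otimes> x) = (r \<otimes> a) \<otimes> x"
      using m_assoc[of a r x] m_comm[of a r] Ac(1)[OF that(1)] r that(2) by simp
    then have "a \<otimes> (r \<otimes> x) = \<zero>" using Ac(2)[OF that(1)] that(2) by simp
    then show "a \<otimes> a = \<zero>" unfolding that(3)[symmetric] .
  qed
  have uniq: "a = b" if "?P d a" "?P d b" for d a b
  proof -
    from that obtain x y where xy: "x \<in> carrier R" "y \<in> carrier R" "d = r \<otimes> x \<oplus> a" "d = r \<otimes> y \<oplus> b"
      and ab: "a \<in> ?A" "b \<in> ?A" by auto
    note c = xy(1,2) r Ac[OF ab(1)] Ac[OF ab(2)]
    have "a \<ominus> b = r \<otimes> (y \<ominus> x)"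
    proof -
      have "a = \<ominus> (r \<otimes> x) \<oplus> (r \<otimes> x \<oplus> a)" using c by (simp add: r_neg1)
      also have "\<dots> = \<ominus> (r \<otimes> x) \<oplus> (r \<otimes> y \<oplus> b)" using xy by simp
      finally have "a = r \<otimes> y \<ominus> r \<otimes> x \<oplus> b" using c by (simp add: minus_eq a_ac)
      then show ?thesis using c by (simp add: minus_eq r_distr r_minus a_assoc r_neg)
    qed
    moreover have "a \<ominus> b \<in> ?A" using Aadd[OF ab(1) Ainv[OF ab(2)]] by (simp add: minus_eq)
    moreover have "y \<ominus> x \<in> carrier R" using c by simp
    ultimately have "a \<ominus> b = \<zero>" using triv by blast
    then show ?thesis using c by simp
  qed
  define D where "D = {d. \<exists>a. ?P d a}"
  define f where "f d = (THE a. ?P d a)" for d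
  have fI: "f d = a" if "?P d a" for d a unfolding f_def using that uniq by blast
  have DI: "d \<in> D" if "?P d a" for d a using that unfolding D_def by blast
  have fD: "?P d (f d)" if "d \<in> D" for d
  proof -
    from that obtain a where a: "?P d a" unfolding D_def by blast
    show ?thesis unfolding fI[OF a] by (rule a)
  qed
  have fP: "f d \<in> ?A" "f d \<in> carrier R" "r \<otimes> f d = \<zero>" if "d \<in> D" for d
    using fD[OF that] Ac by blast+
  have Padd: "?P (d \<oplus> d') (a \<oplus> a')" if "?P d a" "?P d' a'" for d d' a a'
  proof -
    from that obtain x y where xy: "x \<in> carrier R" "y \<in> carrier R" "d = r \<otimes> x \<oplus> a" "d' = r \<otimes> y \<oplus> a'"
      and ab: "a \<in> ?A" "a' \<in> ?A" by auto
    note c = xy(1,2) r Ac[OF ab(1)] Ac[OF ab(2)]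
    have "d \<oplus> d' = r \<otimes> (x \<oplus> y) \<oplus> (a \<oplus> a')" using xy c by (simp add: r_distr a_ac)
    then show ?thesis using c ab Aadd by blast
  qed
  have Pmul: "?P (s \<otimes> d) (s \<otimes> a)" if "?P d a" "s \<in> carrier R" for d s a
  proof -
    from that obtain x where xy: "x \<in> carrier R" "d = r \<otimes> x \<oplus> a" and ab: "a \<in> ?A" by auto
    note c = xy(1) r Ac[OF ab(1)] that(2)
    have "s \<otimes> d = r \<otimes> (s \<otimes> x) \<oplus> (s \<otimes> a)" using xy c by (simp add: r_distr m_lcomm)
    then show ?thesis using c ab Amul by blast
  qed
  have AD: "?P a a" if "a \<in> ?A" for a using that Ac r by (auto intro!: bexI[of _ \<zero>])
  have fA: "a \<in> D" "f a = a" if "a \<in> ?A" for a by (rule DI[OF AD[OF that]], rule fI[OF AD[OF that]])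
  have zA: "\<zero> \<in> ?A" using r by (auto simp: annihilator_def)
  have RD: "?P (r \<otimes> x) \<zero>" if "x \<in> carrier R" for x
    using that r zA by (auto intro!: bexI[of _ x])
  have Dc: "D \<subseteq> carrier R" using Ac r by (auto simp: D_def)
  have dD: "dense_ideal R D"
  proof (rule dense_idealI)
    show "D \<subseteq> carrier R" by (rule Dc)
    show "\<zero> \<in> D" by (rule DI[OF AD[OF zA]])
    show "x \<oplus> y \<in> D" if "x \<in> D" "y \<in> D" for x y using that by (intro DI[OF Padd[OF fD fD]])
    show "s \<otimes> x \<in> D" if "s \<in> carrier R" "x \<in> D" for s x using that by (intro DI[OF Pmul[OF fD]])
    show "dense_set D" unfolding dense_set_def
    proof (intro conjI ballI impI, rule Dc)
      fix s assume s: "s \<in> carrier R" and z: "\<forall>d\<in>D. s \<otimes> d = \<zero>"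
      have "r \<in> D" using DI[OF RD[OF one_closed]] r by simp
      then have "s \<in> ?A" using s z r by (auto simp: annihilator_def m_comm)
      then have "s \<in> D" using fA by simp
      then show "s = \<zero>" using sq s z by simp
    qed
  qed simp
  let ?F = "(D, restrict f D)"
  have F: "?F \<in> fractions R"
  proof (rule fractionsI[OF dD])
    show "f x \<in> carrier R" if "x \<in> D" for x using fP that by blast
    show "f (x \<oplus> y) = f x \<oplus> f y" if "x \<in> D" "y \<in> D" for x y using that by (intro fI[OF Padd[OF fD fD]])
    show "f (s \<otimes> x) = s \<otimes> f x" if "s \<in> carrier R" "x \<in> D" for s x using that by (intro fI[OF Pmul[OF fD]])
  qed
  let ?e = "frac_class R ?F"
  have eQ: "?e \<in> carrier (Quot_ring R)" using F by (auto simp: Q_carrier)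
  have rQ: "quot_emb R r \<in> carrier (Quot_ring R)" using r frac_of_closed by (auto simp: Q_carrier quot_emb_def)
  have idem: "?e \<otimes>\<^bsub>Quot_ring R\<^esub> ?e = ?e"
    using F apply (clarsimp simp: Q_carrier Q_mult frac_mult_closed)
    apply (rule class_eqI)
    apply (auto intro!: frac_add_closed frac_mult_closed frac_of_closed)
    apply (auto simp: frac_mult_def Let_def fA fP)
    done
  have re: "quot_emb R r \<otimes>\<^bsub>Quot_ring R\<^esub> ?e = \<zero>\<^bsub>Quot_ring R\<^esub>"
    using F r apply (simp add: quot_emb_def Q_mult frac_mult_closed Q_eq_zero frac_of_closed)
    apply (auto simp: frac_mult_def Let_def frac_of_def fP)
    done
  have ann: "annihilator (Quot_ring R) (quot_emb R r) =
       (\<lambda>x. ?e \<otimes>\<^bsub>Quot_ring R\<^esub> x) ` carrier (Quot_ring R)" (is "_ = ?E")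
  proof (intro equalityI subsetI)
    fix q assume "q \<in> annihilator (Quot_ring R) (quot_emb R r)"
    then obtain G where G: "G \<in> fractions R" "q = frac_class R G"
      and z: "quot_emb R r \<otimes>\<^bsub>Quot_ring R\<^esub> q = \<zero>\<^bsub>Quot_ring R\<^esub>"
      by (auto simp: annihilator_def Q_carrier)
    have "\<forall>x\<in>fst (frac_mult (frac_of R r) G). snd (frac_mult (frac_of R r) G) x = \<zero>"
      using z G r by (simp add: quot_emb_def Q_mult frac_mult_closed Q_eq_zero frac_of_closed)
    then have "snd G x \<in> ?A" if "x \<in> fst G" for x
      using that G r by (auto simp: frac_mult_def Let_def frac_of_def annihilator_def fractionsD)
    then have "?e \<otimes>\<^bsub>Quot_ring R\<^esub> q = q"
      using F G apply (clarsimp simp: Q_carrier Q_mult frac_mult_closed)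
      apply (rule class_eqI)
      apply (auto intro!: frac_add_closed frac_mult_closed frac_of_closed)
      apply (auto simp: frac_mult_def Let_def fA)
      done
    then show "q \<in> ?E" using G by (metis Q_carrier image_eqI)
  next
    fix q assume "q \<in> ?E"
    then obtain x where x: "x \<in> carrier (Quot_ring R)" "q = ?e \<otimes>\<^bsub>Quot_ring R\<^esub> x" by auto
    have "quot_emb R r \<otimes>\<^bsub>Quot_ring R\<^esub> q = \<zero>\<^bsub>Quot_ring R\<^esub>"
      using x eQ rQ re by (simp add: Q.m_assoc[symmetric])
    then show "q \<in> annihilator (Quot_ring R) (quot_emb R r)" using x eQ by (simp add: annihilator_def)
  qed
  show ?thesis
  proof (rule ex1I[of _ ?e])
    show "is_idempotent (Quot_ring R) ?e \<and> annihilator (Quot_ring R) (quot_emb R r) = ?E"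
      using idem eQ ann by (simp add: is_idempotent_def)
    fix e' assume e': "is_idempotent (Quot_ring R) e' \<and>
       annihilator (Quot_ring R) (quot_emb R r) = (\<lambda>x. e' \<otimes>\<^bsub>Quot_ring R\<^esub> x) ` carrier (Quot_ring R)"
    then have ec: "e' \<in> carrier (Quot_ring R)" "e' \<otimes>\<^bsub>Quot_ring R\<^esub> e' = e'"
      and im: "(\<lambda>x. e' \<otimes>\<^bsub>Quot_ring R\<^esub> x) ` carrier (Quot_ring R) = ?E"
      using ann by (auto simp: is_idempotent_def)
    have "e' \<in> ?E" using ec im by (metis image_eqI)
    then obtain x where x: "x \<in> carrier (Quot_ring R)" "e' = ?e \<otimes>\<^bsub>Quot_ring R\<^esub> x" by auto
    have "?e \<in> (\<lambda>x. e' \<otimes>\<^bsub>Quot_ring R\<^esub> x) ` carrier (Quot_ring R)" using eQ idem im by (metis image_eqI)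
    then obtain y where y: "y \<in> carrier (Quot_ring R)" "?e = e' \<otimes>\<^bsub>Quot_ring R\<^esub> y" by auto
    have "?e \<otimes>\<^bsub>Quot_ring R\<^esub> e' = e'" using x eQ idem by (simp add: Q.m_assoc[symmetric])
    moreover have "e' \<otimes>\<^bsub>Quot_ring R\<^esub> ?e = ?e" using y ec by (metis Q.m_assoc)
    ultimately show "e' = ?e" using Q.m_comm eQ ec by metis
  qed
qed

end

end

theory Submission
  imports Defs
begin

text \<open>
  If \<open>ann\<^sub>R r = eR\<close>, then a fraction \<open>f\<close> annihilated by \<open>r\<close> takes values in \<open>eR\<close>, so that
  \<open>f = e f\<close>.  Hence \<open>ann\<^sub>Q r = eQ\<close> and \<open>e(r) = e\<close> already lies in \<open>R\<close>.
\<close>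

context cring
begin

lemma quot_emb_closed: "r \<in> carrier R \<Longrightarrow> quot_emb R r \<in> carrier (Quot_ring R)"
  by (simp add: quot_emb_def Q_carrier frac_of_closed)

lemma ring_hom_ring_quot_emb: "ring_hom_ring R (Quot_ring R) (quot_emb R)"
  by (rule ring_hom_ringI2[OF ring_axioms cring.axioms(1)[OF Quot_ring_cring] quot_emb_hom])

text \<open>\<open>frac_of R r\<close> is defined on all of \<open>R\<close>, so the preimage on
  which the product lives is the whole domain of \<open>F\<close>. Keeping that domain lets later
  equalities be checked on representatives.\<close>

lemma quot_emb_mult_frac_class:
  assumes "r \<in> carrier R" "F \<in> fractions R"
  shows "quot_emb R r \<otimes>\<^bsub>Quot_ring R\<^esub> frac_class R F =
    frac_class R (fst F, restrict (\<lambda>x. r \<otimes> snd F x) (fst F))"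
proof -
  have "{x \<in> fst F. snd F x \<in> carrier R} = fst F"
    using fractionsD(3)[OF assms(2)] by auto
  then have "frac_mult (frac_of R r) F = (fst F, restrict (\<lambda>x. r \<otimes> snd F x) (fst F))"
    using fractionsD(3)[OF assms(2)]
    by (simp add: frac_mult_def frac_of_def Let_def cong: restrict_cong)
  then show ?thesis
    using assms by (simp add: quot_emb_def Q_mult frac_of_closed)
qed

text \<open>By \<open>Q_eq_zero\<close>, a class vanishes exactly when its representative does so on
  its whole domain. This turns annihilation in the quotient ring into a pointwise condition in
  \<open>R\<close>.\<close>

lemma quot_emb_mult_eq_zero_iff:
  assumes r: "r \<in> carrier R" and F: "F \<in> fractions R"
  shows "quot_emb R r \<otimes>\<^bsub>Quot_ring R\<^esub> frac_class R F = \<zero>\<^bsub>Quot_ring R\<^esub> \<longleftrightarrow>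
    (\<forall>x\<in>fst F. r \<otimes> snd F x = \<zero>)"
proof -
  have "(fst F, restrict (\<lambda>x. r \<otimes> snd F x) (fst F)) \<in> fractions R"
    by (rule fractionsI) (use r fractionsD[OF F] in \<open>auto simp: r_distr m_lcomm\<close>)
  then show ?thesis
    by (simp add: quot_emb_mult_frac_class[OF r F] Q_eq_zero)
qed

lemma is_idempotent_quot_emb:
  assumes "is_idempotent R e"
  shows "is_idempotent (Quot_ring R) (quot_emb R e)"
  using assms ring_hom_mult[OF quot_emb_hom, of e e]
  by (simp add: is_idempotent_def quot_emb_closed)

lemma annihilator_quot_emb:
  assumes r: "r \<in> carrier R" and e: "is_idempotent R e"
    and ann: "annihilator R r = (\<lambda>x. e \<otimes> x) ` carrier R"
  shows "annihilator (Quot_ring R) (quot_emb R r) =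
    (\<lambda>x. quot_emb R e \<otimes>\<^bsub>Quot_ring R\<^esub> x) ` carrier (Quot_ring R)"
proof (intro equalityI subsetI)
  interpret Q: cring "Quot_ring R" by (rule Quot_ring_cring)
  interpret emb: ring_hom_ring R "Quot_ring R" "quot_emb R" by (rule ring_hom_ring_quot_emb)
  have ec: "e \<in> carrier R" "e \<otimes> e = e" using e by (auto simp: is_idempotent_def)
  {
    fix q assume "q \<in> annihilator (Quot_ring R) (quot_emb R r)"
    then obtain F where F: "F \<in> fractions R" "q = frac_class R F"
      and z: "quot_emb R r \<otimes>\<^bsub>Quot_ring R\<^esub> frac_class R F = \<zero>\<^bsub>Quot_ring R\<^esub>"
      by (auto simp: annihilator_def Q_carrier)
    \<comment> \<open>The values of \<open>F\<close> lie in the annihilator of \<open>r\<close>,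
      hence in \<open>eR\<close>, and the idempotent \<open>e\<close> acts as the identity
      there.\<close>
    have fix_e: "e \<otimes> snd F x = snd F x" if "x \<in> fst F" for x
    proof -
      have "snd F x \<in> annihilator R r"
        using z that fractionsD(3)[OF F(1)]
        by (simp add: quot_emb_mult_eq_zero_iff[OF r F(1)] annihilator_def)
      then obtain y where "y \<in> carrier R" "snd F x = e \<otimes> y" unfolding ann by blast
      then show ?thesis using ec by (simp add: m_assoc[symmetric])
    qed
    \<comment> \<open>Since \<open>snd F\<close> is extensional, pointwise agreement makes the
      functions equal outright, so multiplying by \<open>e\<close> returns the pair \<open>F\<close>
      itself.\<close>
    have "restrict (\<lambda>x. e \<otimes> snd F x) (fst F) = snd F"
      using fix_e fractionsD(2)[OF F(1)] by (intro extensionalityI[of _ "fst F"]) auto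
    then have "quot_emb R e \<otimes>\<^bsub>Quot_ring R\<^esub> q = q"
      using F by (simp add: quot_emb_mult_frac_class[OF ec(1)])
    then show "q \<in> (\<lambda>x. quot_emb R e \<otimes>\<^bsub>Quot_ring R\<^esub> x) ` carrier (Quot_ring R)"
      using F Q_carrier by (metis image_eqI)
  next
    fix q assume "q \<in> (\<lambda>x. quot_emb R e \<otimes>\<^bsub>Quot_ring R\<^esub> x) ` carrier (Quot_ring R)"
    then obtain p where p: "p \<in> carrier (Quot_ring R)" "q = quot_emb R e \<otimes>\<^bsub>Quot_ring R\<^esub> p"
      by blast
    \<comment> \<open>Here \<open>e\<close> is the image of \<open>e\<close> under multiplication by
      \<open>e\<close>.\<close>
    have "e \<in> annihilator R r" unfolding ann using ec by (metis image_eqI)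
    then have "quot_emb R r \<otimes>\<^bsub>Quot_ring R\<^esub> quot_emb R e = \<zero>\<^bsub>Quot_ring R\<^esub>"
      using r ec by (simp add: annihilator_def flip: emb.hom_mult)
    then show "q \<in> annihilator (Quot_ring R) (quot_emb R r)"
      using p r ec by (simp add: annihilator_def Q.m_assoc[symmetric])
  }
qed

text \<open>The image of \<open>e\<close> satisfies the description that defines
  \<open>ann_idem R r\<close>; for reduced \<open>R\<close>, \<open>ann_idem_ex1\<close> makes that
  solution unique.\<close>

lemma ann_idem_eq_quot_emb:
  assumes "reduced_ring R" "r \<in> carrier R" "is_idempotent R e"
    and "annihilator R r = (\<lambda>x. e \<otimes> x) ` carrier R"
  shows "ann_idem R r = quot_emb R e"
  unfolding ann_idem_def
  using assms by (intro the1_equality ann_idem_ex1 conjI is_idempotent_quot_emb annihilator_quot_emb)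

end

theorem corollary2p20:
  fixes R :: "('a, 'b) ring_scheme"
  assumes "cring R"
    and "reduced_ring R"
    and "weakly_Baer R"
  shows "W_ring R = quot_emb R ` carrier R"
proof -
  interpret cring R by (rule assms(1))
  interpret emb: ring_hom_ring R "Quot_ring R" "quot_emb R" by (rule ring_hom_ring_quot_emb)
  have "ann_idem R r \<in> quot_emb R ` carrier R" if r: "r \<in> carrier R" for r
  proof -
    obtain e where e: "is_idempotent R e" "annihilator R r = (\<lambda>x. e \<otimes>\<^bsub>R\<^esub> x) ` carrier R"
      using assms(3) r by (auto simp: weakly_Baer_def)
    then show ?thesis
      using ann_idem_eq_quot_emb[OF assms(2) r e] by (auto simp: is_idempotent_def)
  qed
  then have "quot_emb R ` carrier R \<union> ann_idem R ` carrier R = quot_emb R ` carrier R"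
    by blast
  \<comment> \<open>The image of a ring homomorphism is a subring, hence the least subring
    containing itself.\<close>
  moreover have "generate_ring (Quot_ring R) (quot_emb R ` carrier R) = quot_emb R ` carrier R"
    using emb.img_is_subring[OF carrier_is_subring]
    by (intro emb.S.generate_ringI[symmetric]) (auto intro: quot_emb_closed)
  ultimately show ?thesis by (simp add: W_ring_def)
qed

end
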